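(* Let $p,q\neq 2$ be prime numbers with $(p,q)=1$. Then the ring $\mathbb{Z}_{(p)}\cap\mathbb{Z}_{(q)}$ is very clean, but it is not strongly clean.
   Context: For a prime $p$, $\mathbb{Z}_{(p)}\subseteq\mathbb{Q}$ is the localization of $\mathbb{Z}$ at the prime ideal $(p)$, i.e. the rationals that can be written with denominator not divisible by $p$; the intersection is taken in $\mathbb{Q}$. $(p,q)=1$ means that $p$ and $q$ are coprime. $U(R)$ denotes the group of units of a ring $R$. An element $a$ of a ring $R$ is very clean if there exists an idempotent $e\in R$ such that $ae=ea$ and either $a-e\in U(R)$ or $a+e\in U(R)$; $R$ is very clean if every element of $R$ is. An element $a\in R$ is strongly clean if there exist an idempotent $e\in R$ and $u\in U(R)$ with $a=e+u$ and $ae=ea$; $R$ is strongly clean if every element of $R$ is. *)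

theory Defs
  imports "HOL-Algebra.Subrings" "HOL-Algebra.Algebraic_Closure_Type"
begin

definition very_clean_element :: "('a, 'm) ring_scheme \<Rightarrow> 'a \<Rightarrow> bool" where
  "very_clean_element R a \<longleftrightarrow>
     (\<exists>e \<in> carrier R. e \<otimes>\<^bsub>R\<^esub> e = e \<and> a \<otimes>\<^bsub>R\<^esub> e = e \<otimes>\<^bsub>R\<^esub> a \<and>
        (a \<ominus>\<^bsub>R\<^esub> e \<in> Units R \<or> a \<oplus>\<^bsub>R\<^esub> e \<in> Units R))"

definition very_clean_ring :: "('a, 'm) ring_scheme \<Rightarrow> bool" where
  "very_clean_ring R \<longleftrightarrow> (\<forall>a \<in> carrier R. very_clean_element R a)"

definition strongly_clean_element :: "('a, 'm) ring_scheme \<Rightarrow> 'a \<Rightarrow> bool" where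
  "strongly_clean_element R a \<longleftrightarrow>
     (\<exists>e \<in> carrier R. \<exists>u \<in> Units R.
        e \<otimes>\<^bsub>R\<^esub> e = e \<and> a = e \<oplus>\<^bsub>R\<^esub> u \<and> a \<otimes>\<^bsub>R\<^esub> e = e \<otimes>\<^bsub>R\<^esub> a)"

definition strongly_clean_ring :: "('a, 'm) ring_scheme \<Rightarrow> bool" where
  "strongly_clean_ring R \<longleftrightarrow> (\<forall>a \<in> carrier R. strongly_clean_element R a)"

abbreviation rat_ring :: "rat ring" where
  "rat_ring \<equiv> ring_of_type_algebra"

(* No separate side condition that b is nonzero is needed, since p divides 0. *)
definition int_localization :: "nat \<Rightarrow> rat set" where
  "int_localization p = {of_int a / of_int b | a b :: int. \<not> int p dvd b}"

definition int_localization_Int_ring :: "nat \<Rightarrow> nat \<Rightarrow> rat ring" where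
  "int_localization_Int_ring p q =
     rat_ring\<lparr>carrier := int_localization p \<inter> int_localization q\<rparr>"

lemma subring_int_localization:
  assumes "Factorial_Ring.prime p"
  shows "subring (int_localization p) rat_ring"
proof -
  interpret Q: cring rat_ring
    by (rule cring_from_type_algebra)
  have minus: "\<ominus>\<^bsub>rat_ring\<^esub> x = - x" for x
    by (rule Q.minus_equality) (auto simp: ring_of_type_algebra_def)
  have p: "Factorial_Ring.prime (int p)"
    using assms by simp
  have np: "\<not> int p dvd b * d" if "\<not> int p dvd b" "\<not> int p dvd d" for b d
    using that p by (simp add: prime_dvd_mult_iff)
  have loc: "x \<in> int_localization p" if "x = of_int a / of_int b" "\<not> int p dvd b" for x a b
    using that unfolding int_localization_def by blast
  show ?thesis
  proof (rule Q.subringI)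
    show "int_localization p \<subseteq> carrier rat_ring"
      by (simp add: ring_of_type_algebra_def)
    have "\<not> int p dvd 1"
      using p not_prime_unit by blast
    then have "(1::rat) \<in> int_localization p"
      using loc[of 1 1 1] by simp
    then show "\<one>\<^bsub>rat_ring\<^esub> \<in> int_localization p"
      by (simp add: ring_of_type_algebra_def)
  next
    fix x assume "x \<in> int_localization p"
    then obtain a b where "x = of_int a / of_int b" "\<not> int p dvd b"
      by (auto simp: int_localization_def)
    then show "\<ominus>\<^bsub>rat_ring\<^esub> x \<in> int_localization p"
      using loc[of "- x" "- a" b] by (simp add: minus)
  next
    fix x y assume "x \<in> int_localization p" "y \<in> int_localization p"
    then obtain a b c d where x: "x = of_int a / of_int b" "\<not> int p dvd b"
      and y: "y = of_int c / of_int d" "\<not> int p dvd d"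
      by (auto simp: int_localization_def)
    have nz: "b \<noteq> 0" "d \<noteq> 0"
      using x(2) y(2) by auto
    have "x * y = of_int (a * c) / of_int (b * d)"
      by (simp add: x(1) y(1))
    moreover have "x + y = of_int (a * d + c * b) / of_int (b * d)"
      using nz by (simp add: x(1) y(1) add_frac_eq)
    ultimately have "x * y \<in> int_localization p" "x + y \<in> int_localization p"
      by (blast intro: loc[OF _ np[OF x(2) y(2)]])+
    then show "x \<otimes>\<^bsub>rat_ring\<^esub> y \<in> int_localization p"
      and "x \<oplus>\<^bsub>rat_ring\<^esub> y \<in> int_localization p"
      by (simp_all add: ring_of_type_algebra_def)
  qed
qed

lemma ring_int_localization_Int_ring:
  assumes "Factorial_Ring.prime p" and "Factorial_Ring.prime q"
  shows "ring (int_localization_Int_ring p q)"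
proof -
  interpret Q: cring rat_ring
    by (rule cring_from_type_algebra)
  show ?thesis
    unfolding int_localization_Int_ring_def
    by (intro Q.subring_is_ring Q.subring_inter subring_int_localization assms)
qed

end

theory Submission
  imports Defs
begin

text \<open>
  Every element of \<open>R = \<int>\<^sub>(\<^sub>p\<^sub>) \<inter> \<int>\<^sub>(\<^sub>q\<^sub>)\<close> is a fraction \<open>a/b\<close> with one denominator \<open>b\<close> that is
  prime to both \<open>p\<close> and \<open>q\<close>, and such a fraction is a unit exactly when neither \<open>p\<close> nor \<open>q\<close>
  divides \<open>a\<close> (lemma \<open>fraction_in_Units_iff\<close>). As \<open>R\<close> lies in a field, its only idempotents are
  \<open>0\<close> and \<open>1\<close>. Cleanness conditions on \<open>a/b\<close> therefore become divisibility conditions on the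
  numerators \<open>a\<close>, \<open>a - b\<close> and \<open>a + b\<close>.

  Very cleanness asks that one of these three numerators be prime to \<open>p\<close> and \<open>q\<close>. An odd prime
  that does not divide \<open>b\<close> divides at most one of them, since the pairwise differences are
  \<open>b\<close>, \<open>b\<close> and \<open>2b\<close>. Two primes thus spoil at most two of the three.

  Strong cleanness allows only \<open>a\<close> and \<open>a - b\<close>, and then two distinct primes are enough to spoil
  both: an integer \<open>n\<close> with \<open>n \<equiv> 0 (mod p)\<close> and \<open>n \<equiv> 1 (mod q)\<close> exists by the Chinese
  remainder theorem, and neither \<open>n\<close> nor \<open>n - 1\<close> is a unit.
\<close>

lemma cring_int_localization_Int_ring:
  assumes "Factorial_Ring.prime p" and "Factorial_Ring.prime q"
  shows "cring (int_localization_Int_ring p q)"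
proof -
  interpret ring "int_localization_Int_ring p q"
    by (rule ring_int_localization_Int_ring[OF assms])
  show ?thesis
    by unfold_locales
       (simp add: int_localization_Int_ring_def ring_of_type_algebra_def mult.commute)
qed

lemma int_localization_Int_ring_simps:
  "carrier (int_localization_Int_ring p q) = int_localization p \<inter> int_localization q"
  "\<zero>\<^bsub>int_localization_Int_ring p q\<^esub> = 0"
  "\<one>\<^bsub>int_localization_Int_ring p q\<^esub> = 1"
  "x \<oplus>\<^bsub>int_localization_Int_ring p q\<^esub> y = x + y"
  "x \<otimes>\<^bsub>int_localization_Int_ring p q\<^esub> y = x * y"
  by (simp_all add: int_localization_Int_ring_def ring_of_type_algebra_def)

lemma int_localization_Int_ring_minus:
  assumes "Factorial_Ring.prime p" and "Factorial_Ring.prime q"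
    and "x \<in> carrier (int_localization_Int_ring p q)"
    and "y \<in> carrier (int_localization_Int_ring p q)"
  shows "x \<ominus>\<^bsub>int_localization_Int_ring p q\<^esub> y = x - y"
proof -
  let ?R = "int_localization_Int_ring p q"
  interpret R: cring ?R
    by (rule cring_int_localization_Int_ring[OF assms(1,2)])
  have "(x \<ominus>\<^bsub>?R\<^esub> y) \<oplus>\<^bsub>?R\<^esub> y = x"
    using assms(3,4) by (simp add: R.minus_eq R.a_assoc R.l_neg)
  then show ?thesis
    by (simp add: int_localization_Int_ring_simps)
qed

lemma fraction_in_int_localization:
  assumes "\<not> int p dvd b"
  shows "of_int a / of_int b \<in> int_localization p"
  using assms unfolding int_localization_def by blast

text \<open>
  Membership in the two localizations provides two representations with possibly different
  denominators. The reduced fraction serves for both: its denominator divides every other one.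
\<close>

lemma int_localization_Int_common_denominator:
  assumes "x \<in> int_localization p \<inter> int_localization q"
  obtains a b where "x = of_int a / of_int b" "\<not> int p dvd b" "\<not> int q dvd b"
proof -
  obtain a b where x: "x = Rat.Fract a b" and b: "b > 0" and ab: "coprime a b"
    by (cases x)
  have "\<not> int r dvd b" if "x \<in> int_localization r" for r
  proof -
    from that obtain c d where cd: "x = of_int c / of_int d" "\<not> int r dvd d"
      by (auto simp: int_localization_def)
    then have "d \<noteq> 0"
      by auto
    with x b cd have "of_int (a * d) = (of_int (c * b) :: rat)"
      by (simp add: Fract_of_int_quotient field_simps)
    then have "a * d = c * b"
      by (simp only: of_int_eq_iff)
    then have "b dvd a * d"
      by simp
    with ab have "b dvd d"
      by (simp add: coprime_commute coprime_dvd_mult_right_iff)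
    with cd(2) show ?thesis
      using dvd_trans by blast
  qed
  with assms show thesis
    by (intro that[of a b]) (auto simp: x Fract_of_int_quotient)
qed

lemma int_localization_numerator:
  assumes "Factorial_Ring.prime p" and "of_int a / of_int b * y = (1 :: rat)"
    and "y \<in> int_localization p" and "\<not> int p dvd b"
  shows "\<not> int p dvd a"
proof
  assume "int p dvd a"
  from assms(3) obtain c d where y: "y = of_int c / of_int d" and d: "\<not> int p dvd d"
    by (auto simp: int_localization_def)
  have "b \<noteq> 0" "d \<noteq> 0"
    using assms(4) d by auto
  with assms(2) have "of_int (a * c) = (of_int (b * d) :: rat)"
    by (simp add: y field_simps)
  then have "a * c = b * d"
    by (simp only: of_int_eq_iff)
  with \<open>int p dvd a\<close> have "int p dvd b * d"
    by (metis dvd_mult2)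
  with assms(1,4) d show False
    by (simp add: prime_dvd_mult_iff)
qed

lemma fraction_in_Units_iff:
  assumes "Factorial_Ring.prime p" and "Factorial_Ring.prime q"
    and "\<not> int p dvd b" and "\<not> int q dvd b"
  shows "of_int a / of_int b \<in> Units (int_localization_Int_ring p q)
           \<longleftrightarrow> \<not> int p dvd a \<and> \<not> int q dvd a"
proof
  assume "of_int a / of_int b \<in> Units (int_localization_Int_ring p q)"
  then obtain y where "y \<in> int_localization p \<inter> int_localization q"
    and "of_int a / of_int b * y = (1 :: rat)"
    by (auto simp: Units_def int_localization_Int_ring_simps)
  with assms show "\<not> int p dvd a \<and> \<not> int q dvd a"
    using int_localization_numerator by blast
next
  assume a: "\<not> int p dvd a \<and> \<not> int q dvd a"
  then have "a \<noteq> 0" "b \<noteq> 0"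
    using assms(3) by auto
  with a assms(3,4) show "of_int a / of_int b \<in> Units (int_localization_Int_ring p q)"
    by (auto simp: Units_def int_localization_Int_ring_simps fraction_in_int_localization
          intro!: bexI[of _ "of_int b / of_int a"])
qed

text \<open>
  The counting step behind very cleanness: since \<open>p\<close> is odd and prime to \<open>b\<close>, it cannot divide a
  difference \<open>b\<close> or \<open>2b\<close> of two of the three numbers.
\<close>

lemma odd_prime_dvd_at_most_one:
  fixes a b :: int
  assumes "Factorial_Ring.prime p" and "p \<noteq> 2" and "\<not> int p dvd b"
  shows "\<not> (int p dvd a \<and> int p dvd a - b)"
    and "\<not> (int p dvd a \<and> int p dvd a + b)"
    and "\<not> (int p dvd a - b \<and> int p dvd a + b)"
proof -
  have "\<not> int p dvd 2"
    using assms(1,2) by (metis int_dvd_int_iff of_nat_numeral primes_dvd_imp_eq two_is_prime_nat)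
  with assms(1,3) have "\<not> int p dvd 2 * b"
    by (simp add: prime_dvd_mult_iff)
  moreover have "2 * b = (a + b) - (a - b)"
    by simp
  ultimately show "\<not> (int p dvd a - b \<and> int p dvd a + b)"
    by (metis dvd_diff)
  show "\<not> (int p dvd a \<and> int p dvd a - b)" "\<not> (int p dvd a \<and> int p dvd a + b)"
    using assms(3) by (auto simp: dvd_diff_right_iff dvd_add_right_iff)
qed

lemma very_clean_int_localization_Int_ring:
  assumes "Factorial_Ring.prime p" and "Factorial_Ring.prime q"
    and "p \<noteq> 2" and "q \<noteq> 2"
  shows "very_clean_ring (int_localization_Int_ring p q)"
  unfolding very_clean_ring_def
proof
  let ?R = "int_localization_Int_ring p q"
  interpret R: cring ?R
    by (rule cring_int_localization_Int_ring[OF assms(1,2)])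
  fix x assume x: "x \<in> carrier ?R"
  then obtain a b where ab: "x = of_int a / of_int b"
    and b: "\<not> int p dvd b" "\<not> int q dvd b"
    unfolding int_localization_Int_ring_simps by (rule int_localization_Int_common_denominator)
  have "b \<noteq> 0"
    using b by auto
  then have minus: "x - 1 = of_int (a - b) / of_int b"
    and plus: "x + 1 = of_int (a + b) / of_int b"
    by (simp_all add: ab field_simps)
  have units: "of_int m / of_int b \<in> Units ?R \<longleftrightarrow> \<not> int p dvd m \<and> \<not> int q dvd m" for m
    using fraction_in_Units_iff[OF assms(1,2) b] .
  have "x \<in> Units ?R \<or> x - 1 \<in> Units ?R \<or> x + 1 \<in> Units ?R"
    unfolding minus plus unfolding ab units
    using odd_prime_dvd_at_most_one[OF assms(1,3) b(1), of a]
      odd_prime_dvd_at_most_one[OF assms(2,4) b(2), of a] by blast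
  then consider "x \<oplus>\<^bsub>?R\<^esub> \<zero>\<^bsub>?R\<^esub> \<in> Units ?R"
    | "x \<ominus>\<^bsub>?R\<^esub> \<one>\<^bsub>?R\<^esub> \<in> Units ?R \<or> x \<oplus>\<^bsub>?R\<^esub> \<one>\<^bsub>?R\<^esub> \<in> Units ?R"
    using int_localization_Int_ring_minus[OF assms(1,2) x R.one_closed]
    by (auto simp: int_localization_Int_ring_simps)
  then show "very_clean_element ?R x"
  proof cases
    case 1
    with x show ?thesis
      unfolding very_clean_element_def by (intro bexI[of _ "\<zero>\<^bsub>?R\<^esub>"]) auto
  next
    case 2
    with x show ?thesis
      unfolding very_clean_element_def by (intro bexI[of _ "\<one>\<^bsub>?R\<^esub>"]) auto
  qed
qed

lemma not_strongly_clean_int_localization_Int_ring: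
  assumes "Factorial_Ring.prime p" and "Factorial_Ring.prime q" and "coprime p q"
  shows "\<not> strongly_clean_ring (int_localization_Int_ring p q)"
proof
  let ?R = "int_localization_Int_ring p q"
  assume clean: "strongly_clean_ring ?R"
  have one: "\<not> int p dvd 1" "\<not> int q dvd 1"
    using assms(1,2) by (simp_all add: prime_nat_iff)
  \<comment> \<open>A Bezout relation \<open>u p + v q = 1\<close> makes \<open>n = u p\<close> congruent to \<open>0\<close> modulo \<open>p\<close> and to \<open>1\<close>
    modulo \<open>q\<close>.\<close>
  obtain u v where "u * int p + v * int q = 1"
    using assms(3) by (metis bezout_int coprime_imp_gcd_eq_1 coprime_int_iff)
  then obtain n where n: "int p dvd n" "int q dvd n - 1"
    by (metis add_diff_cancel_left' dvd_minus_iff dvd_triv_right minus_diff_eq)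
  have units: "of_int m \<in> Units ?R \<longleftrightarrow> \<not> int p dvd m \<and> \<not> int q dvd m" for m
    using fraction_in_Units_iff[OF assms(1,2) one] by simp
  have "of_int n \<in> carrier ?R"
    using fraction_in_int_localization[OF one(1), of n]
      fraction_in_int_localization[OF one(2), of n]
    by (simp add: int_localization_Int_ring_simps)
  with clean obtain e w where e: "e * e = e" and w: "w \<in> Units ?R"
    and sum: "of_int n = e + w"
    unfolding strongly_clean_ring_def strongly_clean_element_def int_localization_Int_ring_simps
    by blast
  from e have "e = 0 \<or> e = 1"
    by simp
  with sum have "w = of_int n \<or> w = of_int (n - 1)"
    by auto
  with w n show False
    by (auto simp: units simp del: of_int_diff)
qed

theorem lemma2p4:
  fixes p q :: nat
  assumes "Factorial_Ring.prime p" and "Factorial_Ring.prime q"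
    and "p \<noteq> 2" and "q \<noteq> 2"
    and "coprime p q"
  shows "very_clean_ring (int_localization_Int_ring p q) \<and>
         \<not> strongly_clean_ring (int_localization_Int_ring p q)"
  using very_clean_int_localization_Int_ring not_strongly_clean_int_localization_Int_ring assms
  by blast

end
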